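(* Let $G=\mathrm{GIRG}(n,\beta,w_0,d)$ be a standard GIRG with $\beta=3$ and $d=O(\log\log n)$. Then $\omega(G)=O(\log n/\log\log n)$ asymptotically almost surely.
   Context: Fix constants $\lambda>0$, $w_0>0$, $\beta>2$. A standard GIRG $\mathrm{GIRG}(n,\beta,w_0,d)$ has $n$ vertices; each vertex $v$ independently receives a weight $w_v$ with $\Pr[w_v\le x]=1-(x/w_0)^{1-\beta}$ for $x\ge w_0$, and independently a position $\mathbf{x}_v$ uniform on the torus $\mathbb{T}^d=[0,1)^d$. The distance is $d(\mathbf{x}_u,\mathbf{x}_v)=\max_{1\le i\le d}|x_{ui}-x_{vi}|_C$ with $|a-b|_C=\min\{|a-b|,1-|a-b|\}$. Distinct $u,v$ are adjacent iff $d(\mathbf{x}_u,\mathbf{x}_v)\le \frac12\big(\frac{\lambda w_uw_v}{n}\big)^{1/d}$. The dimension $d=d(n)$ may depend on $n$. $\omega(G)$ is the size of the largest clique; "asymptotically almost surely" means with probability $1-o(1)$ as $n\to\infty$. *)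

theory Defs
  imports "HOL-Probability.Probability" "HOL-Library.Ramsey" "HOL-Library.Landau_Symbols"
begin

definition weight_cdf :: "real \<Rightarrow> real \<Rightarrow> real \<Rightarrow> real" where
  "weight_cdf \<beta> w\<^sub>0 x = (if x \<ge> w\<^sub>0 then 1 - (x / w\<^sub>0) powr (1 - \<beta>) else 0)"

definition weight_measure :: "real \<Rightarrow> real \<Rightarrow> real measure" where
  "weight_measure \<beta> w\<^sub>0 = interval_measure (weight_cdf \<beta> w\<^sub>0)"

text \<open>Points of the torus \<open>[0,1)\<^sup>d\<close> are functions on the index set \<open>{..<d}\<close>, so that the
  dimension can vary with the number of vertices.\<close>

definition torus_measure :: "nat \<Rightarrow> (nat \<Rightarrow> real) measure" where
  "torus_measure d = PiM {..<d} (\<lambda>_. uniform_measure lborel {0..<1})"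

definition circle_dist :: "real \<Rightarrow> real \<Rightarrow> real" where
  "circle_dist a b = min \<bar>a - b\<bar> (1 - \<bar>a - b\<bar>)"

definition torus_dist :: "nat \<Rightarrow> (nat \<Rightarrow> real) \<Rightarrow> (nat \<Rightarrow> real) \<Rightarrow> real" where
  "torus_dist d x y = Max ((\<lambda>i. circle_dist (x i) (y i)) ` {..<d})"

text \<open>An outcome \<open>\<sigma>\<close> assigns to each vertex \<open>v < n\<close> the pair of its weight and its position.
  The random graph is the edge set \<open>girg_edges lam n d \<sigma>\<close> on the vertex set \<open>{..<n}\<close>, with \<open>\<sigma>\<close>
  drawn from \<open>girg_measure \<beta> w\<^sub>0 n d\<close>.\<close>

definition girg_measure :: "real \<Rightarrow> real \<Rightarrow> nat \<Rightarrow> nat \<Rightarrow> (nat \<Rightarrow> real \<times> (nat \<Rightarrow> real)) measure" where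
  "girg_measure \<beta> w\<^sub>0 n d = PiM {..<n} (\<lambda>_. weight_measure \<beta> w\<^sub>0 \<Otimes>\<^sub>M torus_measure d)"

definition girg_edges :: "real \<Rightarrow> nat \<Rightarrow> nat \<Rightarrow> (nat \<Rightarrow> real \<times> (nat \<Rightarrow> real)) \<Rightarrow> nat set set" where
  "girg_edges lam n d \<sigma> =
     {{u, v} | u v. u < n \<and> v < n \<and> u \<noteq> v \<and>
        torus_dist d (snd (\<sigma> u)) (snd (\<sigma> v))
          \<le> 1 / 2 * (lam * fst (\<sigma> u) * fst (\<sigma> v) / real n) powr (1 / real d)}"

definition clique_number :: "'a set \<Rightarrow> 'a set set \<Rightarrow> nat" where
  "clique_number V E = Max (card ` {K. K \<subseteq> V \<and> clique K E})"

lemma real_distribution_weight_measure: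
  assumes "\<beta> > 1" "w\<^sub>0 > 0"
  shows "real_distribution (weight_measure \<beta> w\<^sub>0)"
    and "cdf (weight_measure \<beta> w\<^sub>0) = weight_cdf \<beta> w\<^sub>0"
proof -
  let ?F = "weight_cdf \<beta> w\<^sub>0"
  have eq: "?F = (\<lambda>x. 1 - (max x w\<^sub>0 / w\<^sub>0) powr (1 - \<beta>))"
    using assms by (auto simp: weight_cdf_def fun_eq_iff max_def)
  have mono: "?F x \<le> ?F y" if "x \<le> y" for x y
    unfolding eq using assms that
    by (intro diff_left_mono powr_mono2' divide_right_mono) (auto simp: max_def)
  have "continuous_on UNIV ?F"
    unfolding eq using assms by (intro continuous_intros) (auto simp: max_def)
  then have cont: "continuous (at_right a) ?F" for a
    by (simp add: continuous_on_eq_continuous_at continuous_at_imp_continuous_at_within)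
  have "eventually (\<lambda>x. 0 = ?F x) at_bot"
    using eventually_gt_at_bot[of w\<^sub>0] by eventually_elim (auto simp: weight_cdf_def)
  then have bot: "(?F \<longlongrightarrow> 0) at_bot"
    by (rule Lim_transform_eventually[OF tendsto_const])
  have "filterlim (\<lambda>x. x / w\<^sub>0) at_top at_top"
    using assms filterlim_tendsto_pos_mult_at_top[OF tendsto_const, of "1 / w\<^sub>0" "\<lambda>x. x" at_top]
    by (simp add: filterlim_ident)
  then have "((\<lambda>x. 1 - (x / w\<^sub>0) powr (1 - \<beta>)) \<longlongrightarrow> 1 - 0) at_top"
    using assms by (intro tendsto_diff tendsto_const tendsto_neg_powr) auto
  moreover have "eventually (\<lambda>x. 1 - (x / w\<^sub>0) powr (1 - \<beta>) = ?F x) at_top"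
    using eventually_ge_at_top[of w\<^sub>0] by eventually_elim (auto simp: weight_cdf_def)
  ultimately have top: "(?F \<longlongrightarrow> 1) at_top"
    using Lim_transform_eventually by fastforce
  show "real_distribution (weight_measure \<beta> w\<^sub>0)"
    unfolding weight_measure_def
    by (rule real_distribution_interval_measure[OF mono cont bot top])
  show "cdf (weight_measure \<beta> w\<^sub>0) = ?F"
    unfolding weight_measure_def
    by (rule cdf_interval_measure[OF mono cont bot])
qed

end

theory Submission
  imports Defs "HOL-Real_Asymp.Real_Asymp"
begin

text \<open>A vertex of weight \<open>y\<close> is adjacent to one of weight \<open>w\<close> with probability at most
  \<open>\<lambda> y w / n\<close>, in any dimension. For \<open>\<beta> = 3\<close> the truncated mean \<open>E[w; w \<ge> y]\<close> is \<open>O(1 / y)\<close>, so the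
  expected number of neighbours of at least the same weight is bounded by a constant \<open>c\<close> that does
  not depend on \<open>y\<close>. In a clique with more than \<open>k\<close> vertices the lightest one has \<open>k\<close> such neighbours;
  as these are conditionally independent, the union bound shows that such a clique exists with
  probability at most \<open>n c\<^sup>k / k!\<close>, which vanishes for \<open>k = \<lfloor>2 ln n / ln (ln n)\<rfloor>\<close>.\<close>

section \<open>Arcs of the circle, the exponential series, and the clique number\<close>

text \<open>A ball of radius below 1/2 on the circle of length 1 is an arc of length
  \<open>2 * r\<close>; cut open at 0 it becomes one or two intervals of the same total length. For
  \<open>r \<ge> 1 / 2\<close> the bound is at least the total mass 1.\<close>

lemma emeasure_circle_ball_le:
  fixes a r :: real
  assumes "0 \<le> a" "a < 1" "0 \<le> r"
  shows "emeasure lborel ({0..<1} \<inter> {b. circle_dist a b \<le> r}) \<le> ennreal (2 * r)"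
proof (cases "r \<ge> 1 / 2")
  case True
  have "emeasure lborel ({0..<1} \<inter> {b. circle_dist a b \<le> r}) \<le> emeasure lborel {0..<1::real}"
    by (intro emeasure_mono) auto
  also have "\<dots> \<le> ennreal (2 * r)"
    using True by (simp flip: ennreal_1)
  finally show ?thesis .
next
  case False
  have *: ?thesis if "{0..<1} \<inter> {b. circle_dist a b \<le> r} \<subseteq> {p..q} \<union> {s..t}"
     "p \<le> q" "s \<le> t" "q - p + (t - s) = 2 * r" for p q s t :: real
  proof -
    have "emeasure lborel ({0..<1} \<inter> {b. circle_dist a b \<le> r}) \<le> emeasure lborel ({p..q} \<union> {s..t})"
      using that by (intro emeasure_mono) auto
    also have "\<dots> \<le> emeasure lborel {p..q} + emeasure lborel {s..t}"
      by (intro emeasure_subadditive) auto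
    also have "\<dots> = ennreal (2 * r)"
      using that by (simp flip: ennreal_plus)
    finally show ?thesis .
  qed
  \<comment> \<open>The arc passes 0 on the left, reaches 1 on the right, or does neither; in the
    last case the second interval is the degenerate \<open>{0..0}\<close>.\<close>
  consider "a < r" | "a + r \<ge> 1" | "r \<le> a" "a + r < 1" by linarith
  then show ?thesis
  proof cases
    case 1
    with False assms show ?thesis
      by (intro *[of 0 "a + r" "a + 1 - r" 1]) (auto simp: circle_dist_def)
  next
    case 2
    with False assms show ?thesis
      by (intro *[of 0 "a - 1 + r" "a - r" 1]) (auto simp: circle_dist_def)
  next
    case 3
    with False assms show ?thesis
      by (intro *[of "a - r" "a + r" 0 0]) (auto simp: circle_dist_def)
  qed
qed

text \<open>\<open>x ^ k / fact k\<close> is a single term of the series of \<open>exp x\<close>.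
  Rescaling by \<open>(c / x) ^ k\<close> leaves \<open>x\<close> free, so a good choice of
  \<open>x\<close> later takes the place of Stirling's formula.\<close>

lemma power_over_fact_le:
  fixes c x :: real
  assumes "c \<ge> 0" "x > 0"
  shows "c ^ k / fact k \<le> (c / x) ^ k * exp x"
proof -
  have "x ^ k /\<^sub>R fact k \<le> (\<Sum>j. x ^ j /\<^sub>R fact j)"
    using assms summable_exp_generic[of x] sum_le_suminf[of "\<lambda>j. x ^ j /\<^sub>R fact j" "{k}"] by simp
  then have "x ^ k / fact k \<le> exp x"
    by (simp add: exp_def divide_inverse mult.commute)
  then have "(c / x) ^ k * (x ^ k / fact k) \<le> (c / x) ^ k * exp x"
    using assms by (intro mult_left_mono) auto
  then show ?thesis
    using assms by (simp add: power_divide)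
qed

lemma clique_number_le_iff:
  assumes "finite V"
  shows "clique_number V E \<le> m \<longleftrightarrow> (\<forall>K\<in>Pow V. clique K E \<longrightarrow> card K \<le> m)"
proof -
  \<comment> \<open>The empty set is a clique, so \<open>Max\<close> is taken over a nonempty
    set.\<close>
  have "card ` {K. K \<subseteq> V \<and> clique K E} \<noteq> {}"
    by (auto simp: clique_def)
  then show ?thesis
    using assms by (auto simp: clique_number_def Max_le_iff)
qed

section \<open>Tail and truncated mean of the weights for \<beta> = 3\<close>

text \<open>The factor 4 comes from reading the tail off the distribution function at
  \<open>t / 2\<close>: \<open>{t..}\<close> lies in the complement of \<open>{..t / 2}\<close>, so
  the closed endpoint needs no separate argument. If \<open>t / 2\<close> is below
  \<open>w\<^sub>0\<close>, the bound is at least 1.\<close>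

lemma weight_tail_le:
  assumes "w\<^sub>0 > 0" "t > 0"
  shows "emeasure (weight_measure 3 w\<^sub>0) {t..} \<le> ennreal (4 * w\<^sub>0\<^sup>2 / t\<^sup>2)"
proof -
  let ?W = "weight_measure 3 w\<^sub>0"
  interpret W: real_distribution ?W
    by (rule real_distribution_weight_measure) (use assms in auto)
  have "W.prob {t..} \<le> W.prob (UNIV - {..t / 2})"
    using assms by (intro W.finite_measure_mono) auto
  also have "\<dots> = 1 - cdf ?W (t / 2)"
    using W.prob_compl[of "{..t/2}"] by (simp add: cdf_def)
  also have "\<dots> = 1 - weight_cdf 3 w\<^sub>0 (t / 2)"
    by (subst real_distribution_weight_measure(2)) (use assms in auto)
  also have "\<dots> \<le> 4 * w\<^sub>0\<^sup>2 / t\<^sup>2"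
  proof (cases "t / 2 \<ge> w\<^sub>0")
    case True
    have "(t / 2 / w\<^sub>0) powr (1 - 3) = 4 * w\<^sub>0\<^sup>2 / t\<^sup>2"
      using assms by (simp add: powr_minus powr_numeral power_divide power2_eq_square divide_simps)
    with True show ?thesis by (simp add: weight_cdf_def)
  next
    case False
    then have "t\<^sup>2 \<le> (2 * w\<^sub>0)\<^sup>2" using assms by (intro power_mono) auto
    with False assms show ?thesis by (simp add: weight_cdf_def power_mult_distrib)
  qed
  finally show ?thesis
    by (simp add: W.emeasure_eq_measure ennreal_leI)
qed

lemma AE_weight_gt:
  assumes "w\<^sub>0 > 0"
  shows "AE w in weight_measure 3 w\<^sub>0. w > w\<^sub>0"
proof -
  let ?W = "weight_measure 3 w\<^sub>0"
  interpret W: real_distribution ?W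
    by (rule real_distribution_weight_measure) (use assms in auto)
  have "cdf ?W w\<^sub>0 = 0"
    by (subst real_distribution_weight_measure(2)) (use assms in \<open>auto simp: weight_cdf_def\<close>)
  then have "{..w\<^sub>0} \<in> null_sets ?W"
    by (auto simp: cdf_def null_sets_def W.emeasure_eq_measure)
  then show ?thesis
    by (rule AE_I') auto
qed

text \<open>Between \<open>2 ^ j * y\<close> and \<open>2 ^ Suc j * y\<close> the tail bound decays
  like the inverse square, so level \<open>j\<close> contributes at most
  \<open>8 * w\<^sub>0\<^sup>2 / y * (1 / 2) ^ j\<close>; the geometric series doubles the constant
  to 16.\<close>

lemma weight_truncated_mean_le:
  assumes "w\<^sub>0 > 0" "y > 0"
  shows "(\<integral>\<^sup>+w. ennreal w * indicator {y..} w \<partial>weight_measure 3 w\<^sub>0) \<le> ennreal (16 * w\<^sub>0\<^sup>2 / y)"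
proof -
  let ?W = "weight_measure 3 w\<^sub>0"
  interpret W: real_distribution ?W
    by (rule real_distribution_weight_measure) (use assms in auto)
  have term_le: "g j \<le> (\<Sum>i. g i)" for g :: "nat \<Rightarrow> ennreal" and j
    using sum_le_suminf[of g "{j}"] by simp
  \<comment> \<open>Split the range \<open>w \<ge> y\<close> dyadically, so that only tail bounds are needed.\<close>
  have "ennreal w * indicator {y..} w \<le> (\<Sum>j. ennreal (2 ^ Suc j * y) * indicator {2 ^ j * y..} w)" for w
  proof (cases "w \<ge> y")
    case True
    define j where "j = nat \<lfloor>log 2 (w / y)\<rfloor>"
    have "log 2 (w / y) \<ge> 0" using True assms by simp
    then have "real j \<le> log 2 (w / y)" "log 2 (w / y) \<le> real (Suc j)"
      unfolding j_def by linarith+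
    then have "2 powr real j \<le> w / y" "w / y \<le> 2 powr real (Suc j)"
      using True assms by (simp_all add: le_log_iff log_le_iff del: of_nat_Suc)
    then have j: "2 ^ j * y \<le> w" "w \<le> 2 ^ Suc j * y"
      using assms unfolding powr_realpow[OF zero_less_numeral] by (simp_all add: field_simps)
    have "ennreal w * indicator {y..} w \<le> ennreal (2 ^ Suc j * y) * indicator {2 ^ j * y..} w"
      using j by (auto intro!: ennreal_leI simp: indicator_def)
    also have "\<dots> \<le> (\<Sum>j. ennreal (2 ^ Suc j * y) * indicator {2 ^ j * y..} w)"
      by (rule term_le)
    finally show ?thesis .
  qed auto
  then have "(\<integral>\<^sup>+w. ennreal w * indicator {y..} w \<partial>?W)
      \<le> (\<integral>\<^sup>+w. (\<Sum>j. ennreal (2 ^ Suc j * y) * indicator {2 ^ j * y..} w) \<partial>?W)"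
    by (intro nn_integral_mono)
  also have "\<dots> = (\<Sum>j. ennreal (2 ^ Suc j * y) * emeasure ?W {2 ^ j * y..})"
    by (simp add: nn_integral_suminf nn_integral_cmult)
  also have "\<dots> \<le> (\<Sum>j. ennreal (8 * w\<^sub>0\<^sup>2 / y * (1 / 2) ^ j))"
  proof (intro suminf_le)
    fix j
    have "ennreal (2 ^ Suc j * y) * emeasure ?W {2 ^ j * y..}
        \<le> ennreal (2 ^ Suc j * y) * ennreal (4 * w\<^sub>0\<^sup>2 / (2 ^ j * y)\<^sup>2)"
      using assms by (intro mult_left_mono weight_tail_le) auto
    also have "\<dots> = ennreal (8 * w\<^sub>0\<^sup>2 / y * (1 / 2) ^ j)"
      using assms by (simp add: power2_eq_square power_divide field_simps flip: ennreal_mult)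
    finally show "ennreal (2 ^ Suc j * y) * emeasure ?W {2 ^ j * y..}
        \<le> ennreal (8 * w\<^sub>0\<^sup>2 / y * (1 / 2) ^ j)" .
  qed auto
  also have "\<dots> = ennreal (8 * w\<^sub>0\<^sup>2 / y * 2)"
    using assms geometric_sums[of "1 / 2 :: real"] 
    by (intro suminf_ennreal_eq sums_mult) auto
  finally show ?thesis by simp
qed

section \<open>Uniform measure on the torus and volumes of balls\<close>

lemma prod_le_power_ennreal:
  fixes f :: "'a \<Rightarrow> ennreal"
  assumes "\<And>i. i \<in> A \<Longrightarrow> f i \<le> q"
  shows "prod f A \<le> q ^ card A"
  using assms by (induction A rule: infinite_finite_induct) (auto intro!: mult_mono)

lemma prob_space_torus_measure: "prob_space (torus_measure d)"
  unfolding torus_measure_def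
  by (intro prob_space_PiM prob_space_uniform_measure) auto

lemma sets_torus_measure [measurable_cong]: "sets (torus_measure d) = sets (PiM {..<d} (\<lambda>_. borel))"
  unfolding torus_measure_def by (intro sets_PiM_cong) auto

lemma sets_weight_measure [measurable_cong]: "sets (weight_measure \<beta> w\<^sub>0) = sets borel"
  by (simp add: weight_measure_def)

lemma measurable_torus_dist:
  "(\<lambda>(x, y). torus_dist d x y) \<in> borel_measurable (torus_measure d \<Otimes>\<^sub>M torus_measure d)"
  unfolding torus_dist_def circle_dist_def case_prod_beta by measurable

lemma torus_dist_le_iff:
  assumes "d \<ge> 1"
  shows "torus_dist d x y \<le> r \<longleftrightarrow> (\<forall>i<d. circle_dist (x i) (y i) \<le> r)"
  using assms by (subst torus_dist_def, subst Max_le_iff) (auto simp: lessThan_empty_iff)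

text \<open>The centre has to lie in \<open>[0,1)\<^sup>d\<close>, since \<open>circle_dist\<close> is negative on points at distance
  more than 1.\<close>

lemma emeasure_torus_ball_le:
  assumes "d \<ge> 1" "r \<ge> 0" "\<forall>i<d. a i \<in> {0..<1}"
  shows "emeasure (torus_measure d) {x \<in> space (torus_measure d). torus_dist d a x \<le> r}
    \<le> ennreal ((2 * r) ^ d)"
proof -
  let ?U = "uniform_measure lborel {0..<1::real}"
  let ?B = "\<lambda>i. {b. circle_dist (a i) b \<le> r}"
  interpret U: prob_space ?U
    by (rule prob_space_uniform_measure) auto
  interpret P: product_sigma_finite "\<lambda>_::nat. ?U" ..
  have [measurable]: "?B i \<in> sets borel" for i
    unfolding circle_dist_def by measurable
  \<comment> \<open>In the maximum metric a ball is a box, so its measure factors over the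
    coordinates.\<close>
  have "{x \<in> space (torus_measure d). torus_dist d a x \<le> r} = PiE {..<d} ?B"
    using assms by (auto simp: torus_dist_le_iff torus_measure_def space_PiM PiE_iff extensional_def)
  then have "emeasure (torus_measure d) {x \<in> space (torus_measure d). torus_dist d a x \<le> r}
      = (\<Prod>i<d. emeasure ?U (?B i))"
    unfolding torus_measure_def by (simp add: P.emeasure_PiM)
  also have "\<dots> \<le> ennreal (2 * r) ^ card {..<d}"
  proof (intro prod_le_power_ennreal)
    fix i assume "i \<in> {..<d}"
    have "emeasure ?U (?B i) = emeasure lborel ({0..<1} \<inter> ?B i)"
      by (subst emeasure_uniform_measure) (auto simp: divide_ennreal_def)
    also have "\<dots> \<le> ennreal (2 * r)"
      using assms \<open>i \<in> {..<d}\<close> by (intro emeasure_circle_ball_le) auto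
    finally show "emeasure ?U (?B i) \<le> ennreal (2 * r)" .
  qed
  also have "\<dots> = ennreal ((2 * r) ^ d)"
    using assms by (simp add: ennreal_power)
  finally show ?thesis .
qed

text \<open>The underlying space contains all extensional real functions on \<open>{..<d}\<close>,
  so lying in the cube is only an almost sure property. It provides admissible centres for the ball
  estimate.\<close>

lemma AE_torus_measure: "AE x in torus_measure d. \<forall>i<d. x i \<in> {0..<1}"
proof -
  have "AE x in torus_measure d. \<forall>i\<in>{..<d}. x i \<in> {0..<1}"
    unfolding torus_measure_def
    by (intro AE_finite_allI AE_PiM_component prob_space_uniform_measure AE_uniform_measureI) auto
  then show ?thesis by (simp only: Ball_def lessThan_iff)
qed

section \<open>Law of a single vertex and edges towards heavier vertices\<close>

definition vertex_measure :: "real \<Rightarrow> nat \<Rightarrow> (real \<times> (nat \<Rightarrow> real)) measure" where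
  "vertex_measure w\<^sub>0 d = weight_measure 3 w\<^sub>0 \<Otimes>\<^sub>M torus_measure d"

text \<open>Stated for the data of two vertices rather than for indices, so that one endpoint can be
  fixed and the other integrated. Ties count as upward, so that the lightest vertex of a clique
  reaches all the others.\<close>

definition up_edge :: "real \<Rightarrow> nat \<Rightarrow> nat \<Rightarrow> real \<times> (nat \<Rightarrow> real) \<Rightarrow> real \<times> (nat \<Rightarrow> real) \<Rightarrow> bool" where
  "up_edge lam n d s t \<longleftrightarrow> fst s \<le> fst t \<and>
     torus_dist d (snd s) (snd t) \<le> 1 / 2 * (lam * fst s * fst t / real n) powr (1 / real d)"

lemma prob_space_vertex_measure:
  assumes "w\<^sub>0 > 0"
  shows "prob_space (vertex_measure w\<^sub>0 d)"
proof -
  interpret W: real_distribution "weight_measure 3 w\<^sub>0"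
    by (rule real_distribution_weight_measure) (use assms in auto)
  show ?thesis
    unfolding vertex_measure_def
    by (intro prob_space_pair W.prob_space_axioms prob_space_torus_measure)
qed

lemma measurable_fst_vertex [measurable]: "fst \<in> vertex_measure w\<^sub>0 d \<rightarrow>\<^sub>M borel"
  unfolding vertex_measure_def by measurable

lemma measurable_snd_vertex [measurable]: "snd \<in> vertex_measure w\<^sub>0 d \<rightarrow>\<^sub>M torus_measure d"
  unfolding vertex_measure_def by measurable

lemma measurable_torus_dist_compose [measurable (raw)]:
  assumes [measurable]: "f \<in> M \<rightarrow>\<^sub>M torus_measure d" "g \<in> M \<rightarrow>\<^sub>M torus_measure d"
  shows "(\<lambda>z. torus_dist d (f z) (g z)) \<in> borel_measurable M"
  using measurable_compose[OF measurable_Pair[OF assms] measurable_torus_dist] by simp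

lemma measurable_adjacent:
  assumes [measurable]: "f \<in> M \<rightarrow>\<^sub>M vertex_measure w\<^sub>0 d" "g \<in> M \<rightarrow>\<^sub>M vertex_measure w\<^sub>0 d"
  shows "Measurable.pred M (\<lambda>z. torus_dist d (snd (f z)) (snd (g z))
    \<le> 1 / 2 * (lam * fst (f z) * fst (g z) / real n) powr (1 / real d))"
  by measurable

lemma measurable_up_edge [measurable (raw)]:
  assumes [measurable]: "f \<in> M \<rightarrow>\<^sub>M vertex_measure w\<^sub>0 d" "g \<in> M \<rightarrow>\<^sub>M vertex_measure w\<^sub>0 d"
  shows "Measurable.pred M (\<lambda>z. up_edge lam n d (f z) (g z))"
  unfolding up_edge_def by measurable

text \<open>This is what the one-edge bound asks of the fixed vertex: a positive weight to divide by
  and a position inside the cube.\<close>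

lemma AE_vertex_measure:
  assumes "w\<^sub>0 > 0"
  shows "AE s in vertex_measure w\<^sub>0 d. fst s > w\<^sub>0 \<and> (\<forall>i<d. snd s i \<in> {0..<1})"
proof -
  interpret W: real_distribution "weight_measure 3 w\<^sub>0"
    by (rule real_distribution_weight_measure) (use assms in auto)
  interpret T: prob_space "torus_measure d" by (rule prob_space_torus_measure)
  interpret pair_prob_space "weight_measure 3 w\<^sub>0" "torus_measure d" ..
  have "AE w in weight_measure 3 w\<^sub>0. AE x in torus_measure d. w > w\<^sub>0 \<and> (\<forall>i<d. x i \<in> {0..<1})"
    using AE_weight_gt[OF assms] by eventually_elim (use AE_torus_measure in simp)
  moreover have [measurable]: "(\<lambda>s. snd s i) \<in> borel_measurable (vertex_measure w\<^sub>0 d)"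
    if "i \<in> {..<d}" for i
    by (rule measurable_compose[OF measurable_snd_vertex]) (use that in measurable)
  have "Measurable.pred (vertex_measure w\<^sub>0 d)
      (\<lambda>s. fst s > w\<^sub>0 \<and> (\<forall>i\<in>{..<d}. snd s i \<in> {0..<1}))"
    unfolding atLeastLessThan_iff by measurable
  ultimately show ?thesis
    unfolding vertex_measure_def
    by (intro AE_pair_measure) (simp_all only: pred_def fst_conv snd_conv Ball_def lessThan_iff)
qed

text \<open>The position is integrated first: for target weight \<open>w\<close> the ball has volume
  at most \<open>lam * fst s * w / n\<close>. Integrating over \<open>w \<ge> fst s\<close> gives
  the truncated mean, whose factor \<open>1 / fst s\<close> cancels the weight of
  \<open>s\<close>.\<close>

lemma nn_integral_up_edge_le:
  assumes "lam > 0" "w\<^sub>0 > 0" "n > 0" "d \<ge> 1" "fst s > 0" "\<forall>i<d. snd s i \<in> {0..<1}"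
    and [measurable]: "s \<in> space (vertex_measure w\<^sub>0 d)"
  shows "(\<integral>\<^sup>+t. indicator {t. up_edge lam n d s t} t \<partial>vertex_measure w\<^sub>0 d)
    \<le> ennreal (16 * lam * w\<^sub>0\<^sup>2 / n)"
proof -
  let ?W = "weight_measure 3 w\<^sub>0" and ?T = "torus_measure d"
  let ?r = "\<lambda>w. 1 / 2 * (lam * fst s * w / real n) powr (1 / real d)"
  interpret T: prob_space ?T by (rule prob_space_torus_measure)
  have s[measurable]: "snd s \<in> space ?T"
    using assms(7) by (auto simp: vertex_measure_def space_pair_measure)
  have "(\<integral>\<^sup>+t. indicator {t. up_edge lam n d s t} t \<partial>vertex_measure w\<^sub>0 d)
      = (\<integral>\<^sup>+w. (\<integral>\<^sup>+x. indicator {t. up_edge lam n d s t} (w, x) \<partial>?T) \<partial>?W)"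
    unfolding vertex_measure_def
    by (subst T.nn_integral_fst) (auto simp: vertex_measure_def[symmetric])
  also have "\<dots> \<le> (\<integral>\<^sup>+w. ennreal (lam * fst s / n) * (ennreal w * indicator {fst s..} w) \<partial>?W)"
  proof (intro nn_integral_mono)
    fix w
    show "(\<integral>\<^sup>+x. indicator {t. up_edge lam n d s t} (w, x) \<partial>?T)
        \<le> ennreal (lam * fst s / n) * (ennreal w * indicator {fst s..} w)"
    proof (cases "fst s \<le> w")
      case True
      have "(\<integral>\<^sup>+x. indicator {t. up_edge lam n d s t} (w, x) \<partial>?T)
          = (\<integral>\<^sup>+x. indicator {x \<in> space ?T. torus_dist d (snd s) x \<le> ?r w} x \<partial>?T)"
        using True by (intro nn_integral_cong) (auto simp: up_edge_def indicator_def)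
      also have "\<dots> = emeasure ?T {x \<in> space ?T. torus_dist d (snd s) x \<le> ?r w}"
        by (intro nn_integral_indicator) measurable
      also have "\<dots> \<le> ennreal ((2 * ?r w) ^ d)"
        using assms by (intro emeasure_torus_ball_le) auto
      \<comment> \<open>The power \<open>d\<close> undoes the root \<open>1 / real d\<close> in the
        connection radius, and the factor 1/2 there offsets the 2 of the diameter, so the dimension
        disappears.\<close>
      also have "(2 * ?r w) ^ d = lam * fst s * w / n"
        using assms True by (simp add: powr_powr flip: powr_realpow')
      also have "ennreal \<dots> = ennreal (lam * fst s / n) * (ennreal w * indicator {fst s..} w)"
        using assms True by (simp flip: ennreal_mult)
      finally show ?thesis .
    qed (auto simp: up_edge_def)
  qed
  also have "\<dots> = ennreal (lam * fst s / n) * (\<integral>\<^sup>+w. ennreal w * indicator {fst s..} w \<partial>?W)"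
    by (intro nn_integral_cmult) measurable
  also have "\<dots> \<le> ennreal (lam * fst s / n) * ennreal (16 * w\<^sub>0\<^sup>2 / fst s)"
    using assms by (intro mult_left_mono weight_truncated_mean_le) auto
  also have "\<dots> = ennreal (16 * lam * w\<^sub>0\<^sup>2 / n)"
    using assms by (simp flip: ennreal_mult)
  finally show ?thesis .
qed

section \<open>Probability of a star of heavier neighbours\<close>

text \<open>Given the data of \<open>v\<close>, the events for the different \<open>u\<close> in
  \<open>S\<close> are independent, so the one-edge bounds multiply.\<close>

lemma emeasure_up_star_le:
  assumes "lam > 0" "w\<^sub>0 > 0" "n > 0" "d \<ge> 1" "v < n" "S \<subseteq> {..<n} - {v}"
  shows "emeasure (PiM {..<n} (\<lambda>_. vertex_measure w\<^sub>0 d))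
    {\<sigma> \<in> space (PiM {..<n} (\<lambda>_. vertex_measure w\<^sub>0 d)). \<forall>u\<in>S. up_edge lam n d (\<sigma> v) (\<sigma> u)}
    \<le> ennreal ((16 * lam * w\<^sub>0\<^sup>2 / n) ^ card S)"
proof -
  let ?V = "vertex_measure w\<^sub>0 d"
  let ?I = "{..<n} - {v}"
  let ?P = "PiM {..<n} (\<lambda>_. ?V)"
  let ?E = "\<lambda>s. {t. up_edge lam n d s t}"
  let ?q = "16 * lam * w\<^sub>0\<^sup>2 / n"
  interpret V: prob_space ?V by (rule prob_space_vertex_measure[OF assms(2)])
  interpret P: product_sigma_finite "\<lambda>_::nat. ?V" ..
  have I: "insert v ?I = {..<n}" using assms by auto
  have fin: "finite S" using assms finite_subset by blast
  have [measurable]: "v \<in> {..<n}" "\<And>u. u \<in> S \<Longrightarrow> u \<in> {..<n}" using assms by auto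
  have prod_eq: "(\<Prod>u\<in>S. indicator (?E (\<sigma> v)) (\<sigma> u) :: ennreal)
      = indicator {\<sigma> \<in> space ?P. \<forall>u\<in>S. up_edge lam n d (\<sigma> v) (\<sigma> u)} \<sigma>" if "\<sigma> \<in> space ?P" for \<sigma>
    using that fin by (auto simp: indicator_def prod_zero_iff)
  have meas: "(\<lambda>\<sigma>. \<Prod>u\<in>S. indicator (?E (\<sigma> v)) (\<sigma> u) :: ennreal) \<in> borel_measurable ?P"
    using fin by measurable
  have "emeasure ?P {\<sigma> \<in> space ?P. \<forall>u\<in>S. up_edge lam n d (\<sigma> v) (\<sigma> u)}
      = (\<integral>\<^sup>+\<sigma>. indicator {\<sigma> \<in> space ?P. \<forall>u\<in>S. up_edge lam n d (\<sigma> v) (\<sigma> u)} \<sigma> \<partial>?P)"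
    using fin by (intro nn_integral_indicator[symmetric]) measurable
  also have "\<dots> = (\<integral>\<^sup>+\<sigma>. (\<Prod>u\<in>S. indicator (?E (\<sigma> v)) (\<sigma> u)) \<partial>?P)"
    by (intro nn_integral_cong prod_eq[symmetric])
  \<comment> \<open>Fubini: the coordinate \<open>v\<close> becomes the outer integral, which
    realises the conditioning on its data \<open>s\<close>.\<close>
  also have "\<dots> = (\<integral>\<^sup>+s. (\<integral>\<^sup>+\<sigma>. (\<Prod>u\<in>S. indicator (?E ((\<sigma>(v := s)) v)) ((\<sigma>(v := s)) u)) \<partial>PiM ?I (\<lambda>_. ?V)) \<partial>?V)"
    using P.product_nn_integral_insert_rev[of ?I v] meas unfolding I by simp
  also have "\<dots> \<le> (\<integral>\<^sup>+s. ennreal (?q ^ card S) \<partial>?V)"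
  proof (intro nn_integral_mono_AE, use AE_vertex_measure[OF assms(2)] AE_space in eventually_elim)
    case (elim s)
    note [measurable] = elim(2)
    have q: "(\<integral>\<^sup>+t. indicator (?E s) t \<partial>?V) \<le> ennreal ?q"
      using assms elim by (intro nn_integral_up_edge_le) auto
    \<comment> \<open>The integral factorises for products over the full index set
      \<open>?I\<close>, so the product over \<open>S\<close> is padded with factors 1; these
      integrate to 1 and are dropped again.\<close>
    have "(\<integral>\<^sup>+\<sigma>. (\<Prod>u\<in>S. indicator (?E ((\<sigma>(v := s)) v)) ((\<sigma>(v := s)) u)) \<partial>PiM ?I (\<lambda>_. ?V))
      = (\<integral>\<^sup>+\<sigma>. (\<Prod>u\<in>?I. if u \<in> S then indicator (?E s) (\<sigma> u) else 1) \<partial>PiM ?I (\<lambda>_. ?V))"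
      using assms by (intro nn_integral_cong prod.mono_neutral_cong_left) auto
    also have "\<dots> = (\<Prod>u\<in>?I. \<integral>\<^sup>+t. (if u \<in> S then indicator (?E s) t else 1) \<partial>?V)"
      by (rule P.product_nn_integral_prod[where f = "\<lambda>u t. if u \<in> S then indicator (?E s) t else 1"]) 
         (auto, measurable)
    also have "\<dots> = (\<Prod>u\<in>S. \<integral>\<^sup>+t. indicator (?E s) t \<partial>?V)"
      using assms by (intro prod.mono_neutral_cong_right) (auto simp: V.emeasure_space_1)
    also have "\<dots> \<le> ennreal ?q ^ card S"
      using q by (intro prod_le_power_ennreal)
    also have "\<dots> = ennreal (?q ^ card S)"
      using assms by (simp add: ennreal_power)
    finally show ?case .
  qed
  also have "\<dots> = ennreal (?q ^ card S)"
    by (simp add: V.emeasure_space_1)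
  finally show ?thesis .
qed

section \<open>From large cliques to stars, and the union bound\<close>

lemma torus_dist_commute: "torus_dist d x y = torus_dist d y x"
  by (simp add: torus_dist_def circle_dist_def abs_minus_commute)

text \<open>\<open>girg_edges\<close> is built from ordered pairs, while \<open>{u, v}\<close>
  forgets the order; symmetry of the adjacency condition reconciles the two.\<close>

lemma in_girg_edges_iff:
  assumes "u < n" "v < n"
  shows "{u, v} \<in> girg_edges lam n d \<sigma> \<longleftrightarrow> u \<noteq> v \<and>
    torus_dist d (snd (\<sigma> u)) (snd (\<sigma> v))
      \<le> 1 / 2 * (lam * fst (\<sigma> u) * fst (\<sigma> v) / real n) powr (1 / real d)"
proof -
  have "torus_dist d (snd (\<sigma> v)) (snd (\<sigma> u)) = torus_dist d (snd (\<sigma> u)) (snd (\<sigma> v))"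
    "lam * fst (\<sigma> v) * fst (\<sigma> u) = lam * fst (\<sigma> u) * fst (\<sigma> v)"
    by (rule torus_dist_commute) simp
  then show ?thesis
    using assms unfolding girg_edges_def
    by (smt (verit) doubleton_eq_iff mem_Collect_eq)
qed

lemma girg_measure_eq: "girg_measure 3 w\<^sub>0 n d = PiM {..<n} (\<lambda>_. vertex_measure w\<^sub>0 d)"
  by (simp add: girg_measure_def vertex_measure_def)

lemma prob_space_girg_measure:
  assumes "w\<^sub>0 > 0"
  shows "prob_space (girg_measure 3 w\<^sub>0 n d)"
  unfolding girg_measure_eq by (intro prob_space_PiM prob_space_vertex_measure assms)

text \<open>With finitely many vertex sets, the event is a finite Boolean combination of adjacency
  events. Its measurability permits passing to the complement.\<close>

lemma measurable_clique_number_le [measurable]: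
  "Measurable.pred (girg_measure 3 w\<^sub>0 n d)
    (\<lambda>\<sigma>. clique_number {..<n} (girg_edges lam n d \<sigma>) \<le> m)"
proof -
  let ?adj = "\<lambda>\<sigma> u v. torus_dist d (snd (\<sigma> u)) (snd (\<sigma> v))
      \<le> 1 / 2 * (lam * fst (\<sigma> u) * fst (\<sigma> v) / real n) powr (1 / real d)"
  have iff: "clique_number {..<n} (girg_edges lam n d \<sigma>) \<le> m \<longleftrightarrow>
      (\<forall>K\<in>Pow {..<n}. (\<forall>u\<in>K. \<forall>v\<in>K. u \<noteq> v \<longrightarrow> ?adj \<sigma> u v) \<longrightarrow> card K \<le> m)" for \<sigma>
    unfolding clique_number_le_iff[OF finite_lessThan] clique_def
    by (intro ball_cong refl) (auto simp: in_girg_edges_iff subset_iff)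
  have adj: "Measurable.pred (girg_measure 3 w\<^sub>0 n d) (\<lambda>\<sigma>. ?adj \<sigma> u v)" if "u < n" "v < n" for u v
    unfolding girg_measure_eq
    by (intro measurable_adjacent[where w\<^sub>0 = w\<^sub>0] measurable_component_singleton) (use that in auto)
  have "Measurable.pred (girg_measure 3 w\<^sub>0 n d)
      (\<lambda>\<sigma>. (\<forall>u\<in>K. \<forall>v\<in>K. u \<noteq> v \<longrightarrow> ?adj \<sigma> u v) \<longrightarrow> card K \<le> m)" if "K \<in> Pow {..<n}" for K
    using that by (intro pred_intros_logic pred_intros_finite adj) (auto intro: finite_subset)
  moreover have "finite (Pow {..<n})"
    by blast
  ultimately show ?thesis
    unfolding iff by (intro pred_intros_finite(3))
qed

text \<open>Removing the lightest vertex from a clique with more than \<open>k\<close> vertices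
  leaves at least \<open>k\<close>; exactly \<open>k\<close> of them are kept, so that the union
  bound runs over sets of one size.\<close>

lemma ex_up_star_if_clique_number_gt:
  assumes "k < clique_number {..<n} (girg_edges lam n d \<sigma>)"
  obtains v S where "v < n" "S \<subseteq> {..<n} - {v}" "card S = k" "\<And>u. u \<in> S \<Longrightarrow> up_edge lam n d (\<sigma> v) (\<sigma> u)"
proof -
  obtain K where K: "K \<subseteq> {..<n}" "clique K (girg_edges lam n d \<sigma>)" "k < card K"
    using assms clique_number_le_iff[of "{..<n}" "girg_edges lam n d \<sigma>" k] by (auto simp: not_le)
  then have fin: "finite K" "K \<noteq> {}" by (auto intro: finite_subset)
  obtain v where v: "v \<in> K" "\<And>u. u \<in> K \<Longrightarrow> fst (\<sigma> v) \<le> fst (\<sigma> u)"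
    using ex_min_if_finite[of "(\<lambda>u. fst (\<sigma> u)) ` K"] fin by (auto simp: not_less)
  have "k \<le> card (K - {v})" using K v fin by simp
  then obtain S where S: "S \<subseteq> K - {v}" "card S = k"
    by (meson obtain_subset_with_card_n)
  have "up_edge lam n d (\<sigma> v) (\<sigma> u)" if "u \<in> S" for u
  proof -
    have "u \<in> K" "u \<noteq> v" using S that by auto
    then have "{v, u} \<in> girg_edges lam n d \<sigma>" "v < n" "u < n"
      using K v by (auto simp: clique_def)
    then show ?thesis
      using v S that by (auto simp: in_girg_edges_iff up_edge_def)
  qed
  with K v S show ?thesis by (intro that[of v S]) auto
qed

text \<open>Union bound over the centre \<open>v\<close> and the leaf set \<open>S\<close>: there
  are at most \<open>n * (n choose k)\<close> pairs, and
  \<open>n choose k \<le> n ^ k / fact k\<close> cancels the denominator \<open>n ^ k\<close> of the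
  star probability.\<close>

lemma prob_clique_number_gt_le:
  assumes "lam > 0" "w\<^sub>0 > 0" "n > 0" "d \<ge> 1"
  shows "\<P>(\<sigma> in girg_measure 3 w\<^sub>0 n d. k < clique_number {..<n} (girg_edges lam n d \<sigma>))
    \<le> n * ((16 * lam * w\<^sub>0\<^sup>2) ^ k / fact k)"
proof -
  let ?G = "girg_measure 3 w\<^sub>0 n d" and ?c = "16 * lam * w\<^sub>0\<^sup>2"
  let ?A = "\<lambda>(v, S). {\<sigma> \<in> space ?G. \<forall>u\<in>S. up_edge lam n d (\<sigma> v) (\<sigma> u)}"
  let ?I = "SIGMA v:{..<n}. {S. S \<subseteq> {..<n} - {v} \<and> card S = k}"
  interpret G: prob_space ?G
    by (rule prob_space_girg_measure) (use assms in auto)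
  have A: "?A p \<in> sets ?G" "G.prob (?A p) \<le> (?c / n) ^ k" if "p \<in> ?I" for p
  proof -
    obtain v S where p: "p = (v, S)" "v < n" "S \<subseteq> {..<n} - {v}" "card S = k"
      using \<open>p \<in> ?I\<close> by auto
    have [simp]: "finite S" using p finite_subset by blast
    have [measurable]: "v \<in> {..<n}" "\<And>u. u \<in> S \<Longrightarrow> u \<in> {..<n}" using p by auto
    have "{\<sigma> \<in> space ?G. \<forall>u\<in>S. up_edge lam n d (\<sigma> v) (\<sigma> u)} \<in> sets ?G"
      unfolding girg_measure_eq by measurable
    then show "?A p \<in> sets ?G" by (simp add: p)
    have "ennreal (G.prob (?A p)) \<le> ennreal ((?c / n) ^ k)"
      using emeasure_up_star_le[OF assms p(2,3)] p
      unfolding G.emeasure_eq_measure[symmetric] by (simp add: girg_measure_eq)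
    then show "G.prob (?A p) \<le> (?c / n) ^ k"
      using assms by (simp add: ennreal_le_iff)
  qed
  have fin: "finite ?I" by auto
  have "card ?I = (\<Sum>v<n. (n - 1) choose k)"
    by (subst card_SigmaI) (auto simp: n_subsets)
  also have "\<dots> \<le> n * (n choose k)"
    by (simp add: binomial_right_mono)
  finally have card: "card ?I \<le> n * (n choose k)" .
  have "real ((n choose k) * fact k) \<le> real (n ^ k)"
    by (intro of_nat_mono binomial_fact_pow)
  then have choose: "real (n choose k) \<le> real n ^ k / fact k"
    by (simp add: field_simps)
  have "\<P>(\<sigma> in ?G. k < clique_number {..<n} (girg_edges lam n d \<sigma>)) \<le> G.prob (\<Union>p\<in>?I. ?A p)"
  proof (intro G.finite_measure_mono)
    show "{\<sigma> \<in> space ?G. k < clique_number {..<n} (girg_edges lam n d \<sigma>)} \<subseteq> (\<Union>p\<in>?I. ?A p)"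
    proof
      fix \<sigma> assume \<sigma>: "\<sigma> \<in> {\<sigma> \<in> space ?G. k < clique_number {..<n} (girg_edges lam n d \<sigma>)}"
      then obtain v S where "v < n" "S \<subseteq> {..<n} - {v}" "card S = k"
          "\<And>u. u \<in> S \<Longrightarrow> up_edge lam n d (\<sigma> v) (\<sigma> u)"
        using ex_up_star_if_clique_number_gt by blast
      with \<sigma> show "\<sigma> \<in> (\<Union>p\<in>?I. ?A p)"
        by (intro UN_I[of "(v, S)"]) auto
    qed
    show "(\<Union>p\<in>?I. ?A p) \<in> sets ?G"
      using fin A(1) by (intro sets.finite_UN)
  qed
  also have "\<dots> \<le> (\<Sum>p\<in>?I. G.prob (?A p))"
    using fin A(1) by (intro G.finite_measure_subadditive_finite) auto
  also have "\<dots> \<le> (\<Sum>p\<in>?I. (?c / n) ^ k)"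
    using A(2) by (intro sum_mono)
  also have "\<dots> = real (card ?I) * (?c / n) ^ k"
    by simp
  also have "\<dots> \<le> real (n * (n choose k)) * (?c / n) ^ k"
    using card assms by (intro mult_right_mono of_nat_mono) auto
  also have "\<dots> \<le> real n * (real n ^ k / fact k) * (?c / n) ^ k"
    using choose assms unfolding of_nat_mult by (intro mult_right_mono mult_left_mono) auto
  also have "\<dots> = n * (?c ^ k / fact k)"
    using assms by (simp add: power_divide)
  finally show ?thesis .
qed

section \<open>Asymptotics of the failure probability\<close>

theorem theorem16:
  fixes lam w\<^sub>0 :: real and d :: "nat \<Rightarrow> nat"
  assumes "lam > 0" and "w\<^sub>0 > 0"
    and "\<And>n. d n \<ge> 1"
    and "(\<lambda>n. real (d n)) \<in> O(\<lambda>n. ln (ln (real n)))"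
  shows "\<exists>C > 0. (\<lambda>n. \<P>(\<sigma> in girg_measure 3 w\<^sub>0 n (d n).
            real (clique_number {..<n} (girg_edges lam n (d n) \<sigma>))
              \<le> C * (ln (real n) / ln (ln (real n))))) \<longlonglongrightarrow> 1"
\<comment> \<open>The witness for \<open>C\<close> stays schematic here; the final
  \<open>show\<close> instantiates it to 2.\<close>
proof (intro exI conjI)
  define c where "c = 16 * lam * w\<^sub>0\<^sup>2"
  define L where "L n = ln (real n) / ln (ln (real n))" for n
  let ?P = "\<lambda>n. \<P>(\<sigma> in girg_measure 3 w\<^sub>0 n (d n).
            real (clique_number {..<n} (girg_edges lam n (d n) \<sigma>)) \<le> 2 * L n)"
  have c: "c > 0" using assms by (simp add: c_def)
  \<comment> \<open>This will bound the failure probability: \<open>power_over_fact_le\<close> is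
    applied with \<open>x = L n\<close>, and \<open>k\<close> is replaced by the lower bound
    \<open>2 * L n - 1\<close>. As \<open>L n * ln (L n)\<close> is asymptotic to
    \<open>ln n\<close>, the logarithm of \<open>?e n\<close> behaves like
    \<open>ln n - 2 * ln n\<close>, so the constant 2 beats the factor \<open>n\<close>.\<close>
  let ?e = "\<lambda>n. real n * ((c / L n) powr (2 * L n - 1) * exp (L n))"
  have e: "?e \<longlonglongrightarrow> 0"
    unfolding L_def using c by real_asymp
  have "filterlim L at_top sequentially"
    unfolding L_def by real_asymp
  \<comment> \<open>From here on the base \<open>c / L n\<close> is below 1, so lowering the
    exponent can only increase the power.\<close>
  then have "eventually (\<lambda>n. L n > c) sequentially"
    by (simp add: filterlim_at_top_dense)
  then have lower: "eventually (\<lambda>n. 1 - ?e n \<le> ?P n) sequentially"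
    using eventually_gt_at_top[of 0]
  proof eventually_elim
    case (elim n)
    let ?G = "girg_measure 3 w\<^sub>0 n (d n)"
    let ?\<omega> = "\<lambda>\<sigma>. clique_number {..<n} (girg_edges lam n (d n) \<sigma>)"
    interpret G: prob_space ?G
      by (rule prob_space_girg_measure) (use assms in auto)
    \<comment> \<open>The clique number is an integer, so rounding down does not change the event;
      it costs at most 1 in the exponent.\<close>
    define k where "k = nat \<lfloor>2 * L n\<rfloor>"
    have L: "L n > 0" using elim c by simp
    then have k: "real k \<ge> 2 * L n - 1" "real m \<le> 2 * L n \<longleftrightarrow> m \<le> k" for m
      unfolding k_def by linarith+
    have "1 - ?P n = 1 - \<P>(\<sigma> in ?G. ?\<omega> \<sigma> \<le> k)"
      by (simp add: k(2))
    also have "\<dots> = \<P>(\<sigma> in ?G. k < ?\<omega> \<sigma>)"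
      by (subst G.prob_neg[symmetric]) (auto simp: not_le)
    also have "\<dots> \<le> n * (c ^ k / fact k)"
      unfolding c_def using assms elim by (intro prob_clique_number_gt_le) auto
    also have "\<dots> \<le> n * ((c / L n) ^ k * exp (L n))"
      using c L by (intro mult_left_mono power_over_fact_le) auto
    also have "(c / L n) ^ k = (c / L n) powr k"
      using c L by (simp add: powr_realpow)
    also have "n * ((c / L n) powr k * exp (L n)) \<le> ?e n"
      using c L k(1) elim by (intro mult_left_mono mult_right_mono powr_mono') auto
    finally show ?case by simp
  qed
  have "?P n \<le> 1" for n
  proof -
    interpret G: prob_space "girg_measure 3 w\<^sub>0 n (d n)"
      by (rule prob_space_girg_measure) (use assms in auto)
    show ?thesis by (rule G.prob_le_1)
  qed
  moreover have "(\<lambda>n. 1 - ?e n) \<longlonglongrightarrow> 1"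
    using tendsto_diff[OF tendsto_const e, of 1] by simp
  ultimately show "(\<lambda>n. \<P>(\<sigma> in girg_measure 3 w\<^sub>0 n (d n).
            real (clique_number {..<n} (girg_edges lam n (d n) \<sigma>))
              \<le> 2 * (ln (real n) / ln (ln (real n))))) \<longlonglongrightarrow> 1"
    unfolding L_def[symmetric] using lower
    by (intro tendsto_sandwich[of "\<lambda>n. 1 - ?e n" ?P sequentially "\<lambda>_. 1"]) auto
qed simp

end
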